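(* For every positive integer $k$ and every finite simple graph $G$, both of the following hold: (i) either $G$ contains no induced path on $k$ vertices, or $G$ contains an induced path on $k$ vertices that is avoidable in $G$; (ii) for every vertex $u \in V(G)$, either $G - N[u]$ contains no induced path on $k$ vertices, or there is an induced path on $k$ vertices with all its vertices in $V(G)\setminus N[u]$ that is avoidable in $G$.
   Context: Graphs are finite, simple and loopless. $N[u]$ denotes the closed neighbourhood of $u$ and $G - Y$ the subgraph induced by $V(G)\setminus Y$. Given an induced path $P$ in $G$, an extension of $P$ is an induced path $xPy$ in $G$ (adding a vertex $x$ adjacent to one endpoint and a vertex $y$ adjacent to the other, the result being an induced path). An induced path $P$ is failing if no induced cycle of $G$ contains $P$. A path $P$ is avoidable in $G$ if it is induced and has no failing extension in $G$ (avoidability is always with respect to the whole graph $G$). *)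

theory Defs
  imports "Graph_Theory.Graph_Theory"
begin

text \<open>
  Finite simple graphs are the locale \<^locale>\<open>graph\<close>: every undirected edge is a pair of opposite
  arcs. Paths and cycles are given by their vertex sequences. The library's \<^verbatim>\<open>cycle\<close> is not used,
  since in a symmetric digraph it also admits the closed walk \<open>a, b, a\<close>.
\<close>

definition walk_edges :: "'a list \<Rightarrow> ('a \<times> 'a) set" where
  "walk_edges p = set (vwalk_arcs p) \<union> (set (vwalk_arcs p))\<inverse>"

definition induced_path :: "('a, 'b) pre_digraph \<Rightarrow> 'a list \<Rightarrow> bool" where
  "induced_path G p \<longleftrightarrow> vpath p G \<and>
     (\<forall>v\<in>set p. \<forall>w\<in>set p. v \<rightarrow>\<^bsub>G\<^esub> w \<longrightarrow> (v, w) \<in> walk_edges p)"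

text \<open>A cycle is listed without repeating its first vertex at the end.\<close>

definition cycle_edges :: "'a list \<Rightarrow> ('a \<times> 'a) set" where
  "cycle_edges c = walk_edges (c @ [hd c])"

definition induced_cycle :: "('a, 'b) pre_digraph \<Rightarrow> 'a list \<Rightarrow> bool" where
  "induced_cycle G c \<longleftrightarrow> 3 \<le> length c \<and> distinct c \<and> vwalk (c @ [hd c]) G \<and>
     (\<forall>v\<in>set c. \<forall>w\<in>set c. v \<rightarrow>\<^bsub>G\<^esub> w \<longrightarrow> (v, w) \<in> cycle_edges c)"

definition cycle_contains_path :: "'a list \<Rightarrow> 'a list \<Rightarrow> bool" where
  "cycle_contains_path c p \<longleftrightarrow> set p \<subseteq> set c \<and> walk_edges p \<subseteq> cycle_edges c"

definition extension :: "('a, 'b) pre_digraph \<Rightarrow> 'a list \<Rightarrow> 'a list \<Rightarrow> bool" where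
  "extension G p q \<longleftrightarrow> induced_path G q \<and> (\<exists>x y. q = x # p @ [y])"

definition failing :: "('a, 'b) pre_digraph \<Rightarrow> 'a list \<Rightarrow> bool" where
  "failing G p \<longleftrightarrow> induced_path G p \<and> \<not> (\<exists>c. induced_cycle G c \<and> cycle_contains_path c p)"

definition avoidable :: "('a, 'b) pre_digraph \<Rightarrow> 'a list \<Rightarrow> bool" where
  "avoidable G p \<longleftrightarrow> induced_path G p \<and> \<not> (\<exists>q. extension G p q \<and> failing G q)"

definition closed_nbhd :: "('a, 'b) pre_digraph \<Rightarrow> 'a \<Rightarrow> 'a set" where
  "closed_nbhd G u = insert u {v. u \<rightarrow>\<^bsub>G\<^esub> v}"

definition delete_verts :: "('a, 'b) pre_digraph \<Rightarrow> 'a set \<Rightarrow> ('a, 'b) pre_digraph" where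
  "delete_verts G Y = G \<restriction> (verts G - Y)"

end

theory Submission
  imports Defs
begin

text \<open>
  If \<open>x # p @ [y]\<close> is an induced path, then \<open>tl p @ [y]\<close> is an induced path with as many vertices
  as \<open>p\<close> that avoids \<open>N[x]\<close>. Hence if no \<open>G - N[x]\<close> contains an induced path on \<open>k\<close> vertices,
  then no induced path on \<open>k\<close> vertices has an extension, and (i) follows from (ii).

  For (ii), take a maximal connected set \<open>U\<close> containing \<open>u\<close> such that \<open>G - N[U]\<close> contains an
  induced path on \<open>k\<close> vertices. By induction \<open>G - N[U]\<close> has such a path \<open>p\<close> that is avoidable in
  \<open>G - N[U]\<close>. Consider an extension of \<open>p\<close> by \<open>x\<close> and \<open>y\<close>. If both lie outside \<open>N[U]\<close>, it is
  contained in an induced cycle of \<open>G - N[U]\<close>. If both lie in \<open>N[U]\<close>, a shortest path from \<open>x\<close>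
  to \<open>y\<close> through \<open>U\<close> closes an induced cycle. If only \<open>x\<close> does, then \<open>tl p @ [y]\<close> avoids
  \<open>N[U \<union> {x}]\<close>, against the maximality of \<open>U\<close>.
\<close>

section \<open>Edges of vertex sequences and induced subpaths\<close>

lemma walk_edges_subset: "walk_edges p \<subseteq> set p \<times> set p"
proof -
  have "set (vwalk_arcs p) \<subseteq> set p \<times> set p"
    by (induction p rule: vwalk_arcs.induct) auto
  then show ?thesis by (auto simp: walk_edges_def)
qed

lemma walk_edges_append:
  assumes "p \<noteq> []" "q \<noteq> []"
  shows "walk_edges (p @ q) = walk_edges p \<union> {(last p, hd q), (hd q, last p)} \<union> walk_edges q"
  using assms by (auto simp: walk_edges_def vwalk_arcs_append)

lemma walk_edges_rev: "walk_edges (rev p) = walk_edges p"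
proof (induction p)
  case (Cons a p)
  show ?case
  proof (cases "p = []")
    case False
    then show ?thesis
      using Cons walk_edges_append[of "rev p" "[a]"] walk_edges_append[of "[a]" p]
      by (auto simp: last_rev walk_edges_def)
  qed simp
qed simp

lemma induced_path_tl:
  assumes "induced_path G (x # q)" "q \<noteq> []"
  shows "induced_path G q"
proof -
  have w: "vwalk q G"
    using vwalkI_append_r[of q "[x]" G] assms by (simp add: induced_path_def vpath_def)
  have e: "walk_edges (x # q) = {(x, hd q), (hd q, x)} \<union> walk_edges q"
    using walk_edges_append[of "[x]" q] assms(2) by (auto simp: walk_edges_def)
  show ?thesis
    unfolding induced_path_def vpath_def
  proof (intro conjI ballI impI)
    fix v w assume "v \<in> set q" "w \<in> set q" "v \<rightarrow>\<^bsub>G\<^esub> w"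
    then show "(v, w) \<in> walk_edges q"
      using assms e by (auto simp: induced_path_def vpath_def)
  qed (use w assms in \<open>auto simp: induced_path_def vpath_def\<close>)
qed

lemma induced_path_hd_nonadjacent:
  assumes "induced_path G (x # q)" "w \<in> set (tl q)"
  shows "w \<notin> closed_nbhd G x"
proof
  assume w: "w \<in> closed_nbhd G x"
  have ne: "q \<noteq> []" and d: "distinct (x # q)" and wq: "w \<in> set q"
    using assms by (auto simp: induced_path_def vpath_def intro: list.set_sel(2))
  have "w \<noteq> x" using d wq by auto
  then have "(x, w) \<in> walk_edges (x # q)"
    using w wq assms(1) by (auto simp: closed_nbhd_def induced_path_def)
  moreover have "walk_edges (x # q) = {(x, hd q), (hd q, x)} \<union> walk_edges q"
    using walk_edges_append[of "[x]" q] ne by (auto simp: walk_edges_def)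
  moreover have "w \<noteq> hd q" using d assms(2) ne by (cases q) auto
  ultimately show False using walk_edges_subset[of q] d by auto
qed

text \<open>On an induced path the end vertex \<open>x\<close> is adjacent only to its successor
  \<open>hd p\<close>. Dropping both leaves vertices outside \<open>N[x]\<close>, and the end
  \<open>y\<close> makes up for the lost \<open>hd p\<close>, so the number of vertices is that of
  \<open>p\<close>.\<close>

lemma induced_path_shift:
  assumes "induced_path G (x # p @ [y])" "p \<noteq> []"
  shows "induced_path G (tl p @ [y])" "set (tl p @ [y]) \<inter> closed_nbhd G x = {}"
proof -
  obtain a p' where p: "p = a # p'" using assms(2) by (cases p) auto
  show "induced_path G (tl p @ [y])"
    using induced_path_tl[of G x "p @ [y]"] induced_path_tl[of G a "p' @ [y]"] assms(1)
    by (simp add: p)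
  show "set (tl p @ [y]) \<inter> closed_nbhd G x = {}"
    using induced_path_hd_nonadjacent[OF assms(1)] by (auto simp: p)
qed

text \<open>Arcs between surviving vertices are the same in the subgraph and in \<open>G\<close>.
  This moves the assumption in (ii) to vertex sets of \<open>G\<close>, where the main argument
  takes place.\<close>

lemma induced_path_delete_verts:
  assumes "induced_path (delete_verts G Y) p"
  shows "induced_path G p" "set p \<subseteq> verts G - Y"
proof -
  let ?H = "G \<restriction> (verts G - Y)"
  have H: "vwalk p ?H" "distinct p"
    "\<And>v w. v \<in> set p \<Longrightarrow> w \<in> set p \<Longrightarrow> v \<rightarrow>\<^bsub>?H\<^esub> w \<Longrightarrow> (v, w) \<in> walk_edges p"
    using assms by (auto simp: induced_path_def vpath_def delete_verts_def)
  show s: "set p \<subseteq> verts G - Y" using H(1) by (auto simp: vwalk_def)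
  have "v \<rightarrow>\<^bsub>?H\<^esub> w" if "v \<in> set p" "w \<in> set p" "v \<rightarrow>\<^bsub>G\<^esub> w" for v w
    using that s by (auto simp: arcs_ends_conv)
  moreover have "vwalk p G"
    using H(1) by (auto simp: vwalk_def dest: dominates_induce_subgraphD)
  ultimately show "induced_path G p"
    using H by (auto simp: induced_path_def vpath_def)
qed

section \<open>Connectedness and avoidability relative to a vertex set\<close>

definition connected_in :: "('a, 'b) pre_digraph \<Rightarrow> 'a set \<Rightarrow> bool" where
  "connected_in G U \<longleftrightarrow> (\<forall>a\<in>U. \<forall>b\<in>U. (a, b) \<in> (Restr (arcs_ends G) U)\<^sup>*)"

text \<open>For \<open>W \<subseteq> verts G\<close> this is avoidability in the subgraph induced by
  \<open>W\<close>. Phrased with paths and cycles of \<open>G\<close>, it lets the induction run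
  over vertex sets while the graph stays fixed.\<close>

definition avoidable_within :: "('a, 'b) pre_digraph \<Rightarrow> 'a set \<Rightarrow> 'a list \<Rightarrow> bool" where
  "avoidable_within G W p \<longleftrightarrow> induced_path G p \<and> set p \<subseteq> W \<and>
     (\<forall>x\<in>W. \<forall>y\<in>W. induced_path G (x # p @ [y]) \<longrightarrow>
        (\<exists>c. induced_cycle G c \<and> set c \<subseteq> W \<and> cycle_contains_path c (x # p @ [y])))"

lemma avoidable_if_avoidable_within_verts:
  assumes "avoidable_within G (verts G) p"
  shows "avoidable G p"
proof -
  have "\<not> failing G q" if ext: "extension G p q" for q
  proof -
    obtain x y where q: "q = x # p @ [y]" and ip: "induced_path G q"
      using ext unfolding extension_def by blast
    then have "x \<in> verts G" "y \<in> verts G"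
      by (auto simp: induced_path_def vpath_def vwalk_def)
    then show ?thesis
      using assms ip unfolding q avoidable_within_def failing_def by blast
  qed
  then show ?thesis using assms by (auto simp: avoidable_within_def avoidable_def)
qed

section \<open>Symmetry, chordless walks and induced cycles\<close>

context graph
begin

lemma adj_sym: "v \<rightarrow>\<^bsub>G\<^esub> w \<longleftrightarrow> w \<rightarrow>\<^bsub>G\<^esub> v"
  using sym_arcs by (auto simp: symmetric_def dest: symD)

lemma closed_nbhd_sym: "v \<in> closed_nbhd G w \<longleftrightarrow> w \<in> closed_nbhd G v"
  using adj_sym by (auto simp: closed_nbhd_def)

lemma walk_edges_subset_arcs_ends:
  "walk_edges p \<subseteq> arcs_ends G \<longleftrightarrow> set (vwalk_arcs p) \<subseteq> arcs_ends G"
  unfolding walk_edges_def using adj_sym by blast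

text \<open>Since arcs are symmetric, being a walk becomes an inclusion of undirected edge sets.
  Reversal and gluing then reduce to computations with these sets.\<close>

lemma induced_path_iff:
  "induced_path G p \<longleftrightarrow> p \<noteq> [] \<and> distinct p \<and> set p \<subseteq> verts G \<and> walk_edges p \<subseteq> arcs_ends G \<and>
     (\<forall>v\<in>set p. \<forall>w\<in>set p. v \<rightarrow>\<^bsub>G\<^esub> w \<longrightarrow> (v, w) \<in> walk_edges p)"
  unfolding induced_path_def vpath_def vwalk_def walk_edges_subset_arcs_ends by blast

lemma induced_path_rev: "induced_path G (rev p) \<longleftrightarrow> induced_path G p"
  by (simp add: induced_path_iff walk_edges_rev)

lemma extension_hd_adjacent:
  assumes "induced_path G (x # p @ [y])" "p \<noteq> []"
  shows "x \<rightarrow>\<^bsub>G\<^esub> hd p"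
  using assms by (auto simp: induced_path_def vpath_def vwalk_def)

text \<open>A shortest walk has no chords.\<close>

lemma induced_path_if_reachable_within:
  assumes "(x, y) \<in> (Restr (arcs_ends G) S)\<^sup>*" "x \<in> S" "S \<subseteq> verts G"
  shows "\<exists>q. induced_path G q \<and> hd q = x \<and> last q = y \<and> set q \<subseteq> S"
proof -
  define Q where "Q q \<longleftrightarrow> q \<noteq> [] \<and> hd q = x \<and> last q = y \<and> set q \<subseteq> S \<and>
      walk_edges q \<subseteq> arcs_ends G" for q
  have "\<exists>q. q \<noteq> [] \<and> hd q = x \<and> last q = y \<and> set q \<subseteq> S \<and> walk_edges q \<subseteq> arcs_ends G"
    using assms(1)
  proof (induction rule: rtrancl_induct)
    case base
    show ?case using assms(2) by (intro exI[of _ "[x]"]) (auto simp: walk_edges_def)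
  next
    case (step y z)
    then obtain q where "q \<noteq> []" "hd q = x" "last q = y" "set q \<subseteq> S" "walk_edges q \<subseteq> arcs_ends G"
      by auto
    with step(2) show ?case
      using walk_edges_append[of q "[z]"] adj_sym[of y z]
      by (intro exI[of _ "q @ [z]"]) (auto simp: walk_edges_def)
  qed
  then obtain q\<^sub>0 where "Q q\<^sub>0" by (auto simp: Q_def)
  \<comment> \<open>\<open>q\<close> is shortest among the walks from \<open>x\<close> to
    \<open>y\<close> inside \<open>S\<close>. A repeated vertex or a chord would yield a shorter
    one.\<close>
  then obtain q where q: "Q q" and least: "\<And>r. Q r \<Longrightarrow> length q \<le> length r"
    by (metis ex_has_least_nat)
  have edges_append: "walk_edges (r @ s) \<subseteq> arcs_ends G \<longleftrightarrow>
      walk_edges r \<subseteq> arcs_ends G \<and> walk_edges s \<subseteq> arcs_ends G \<and> last r \<rightarrow>\<^bsub>G\<^esub> hd s"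
    if "r \<noteq> []" "s \<noteq> []" for r s
    using walk_edges_append[OF that] adj_sym[of "last r" "hd s"] by auto
  have distinct: "distinct q"
  proof (rule ccontr)
    assume "\<not> distinct q"
    then obtain a b c v where qd: "q = a @ [v] @ b @ [v] @ c"
      using not_distinct_decomp by blast
    \<comment> \<open>The competitor omits the closed detour between two visits to
      \<open>v\<close>.\<close>
    have "walk_edges (a @ [v] @ c) \<subseteq> arcs_ends G"
    proof -
      have 1: "walk_edges ([v] @ c) \<subseteq> arcs_ends G"
        using q edges_append[of "a @ [v] @ b" "[v] @ c"] by (simp add: qd Q_def)
      show ?thesis
      proof (cases "a = []")
        case False
        then show ?thesis
          using q 1 edges_append[of a "[v] @ c"] edges_append[of a "[v] @ b @ [v] @ c"]
          by (simp add: qd Q_def)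
      qed (use 1 in simp)
    qed
    then have "Q (a @ [v] @ c)"
      using q by (cases a; cases c rule: rev_cases) (auto simp: qd Q_def)
    from least[OF this] show False by (simp add: qd)
  qed
  \<comment> \<open>Going directly from \<open>v\<close> to \<open>w\<close> skips \<open>b\<close>,
    so minimality leaves nothing to skip.\<close>
  have chord: "b = []" if qd: "q = a @ [v] @ b @ [w] @ c" and vw: "v \<rightarrow>\<^bsub>G\<^esub> w" for a b c v w
  proof -
    have 1: "walk_edges (a @ [v]) \<subseteq> arcs_ends G"
      using q edges_append[of "a @ [v]" "b @ [w] @ c"] by (simp add: qd Q_def)
    have 2: "walk_edges ([w] @ c) \<subseteq> arcs_ends G"
      using q edges_append[of "a @ [v] @ b" "[w] @ c"] by (simp add: qd Q_def)
    have "walk_edges (a @ [v] @ [w] @ c) \<subseteq> arcs_ends G"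
      using 1 2 vw edges_append[of "a @ [v]" "[w] @ c"] by simp
    then have "Q (a @ [v] @ [w] @ c)"
      using q by (cases a) (auto simp: qd Q_def)
    from least[OF this] show ?thesis by (simp add: qd)
  qed
  have consecutive: "(v, w) \<in> walk_edges (a @ [v] @ [w] @ c)" for a c v w
    using walk_edges_append[of "a @ [v]" "[w] @ c"] by simp
  have "(v, w) \<in> walk_edges q" if vw: "v \<in> set q" "w \<in> set q" "v \<rightarrow>\<^bsub>G\<^esub> w" for v w
  proof -
    obtain a d where qd: "q = a @ v # d" using vw(1) by (meson split_list)
    have "v \<noteq> w" using vw(3) adj_not_same by auto
    then consider "w \<in> set d" | "w \<in> set a" using vw(2) qd by auto
    then show ?thesis
    proof cases
      case 1
      then obtain b c where "d = b @ w # c" by (meson split_list)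
      then show ?thesis
        using chord[of a v b w c] vw(3) consecutive[of v w a c] qd by simp
    next
      case 2
      then obtain b c where "a = b @ w # c" by (meson split_list)
      then have "(w, v) \<in> walk_edges q"
        using chord[of b w c v d] vw(3) adj_sym consecutive[of w v b d] qd by simp
      then show ?thesis by (auto simp: walk_edges_def)
    qed
  qed
  then have "induced_path G q"
    using q distinct assms(3) by (auto simp: induced_path_iff Q_def)
  then show ?thesis using q by (auto simp: Q_def)
qed

lemma connected_in_insert:
  assumes "connected_in G U" "u \<in> U" "u \<rightarrow>\<^bsub>G\<^esub> x"
  shows "connected_in G (insert x U)"
proof -
  let ?R = "Restr (arcs_ends G) (insert x U)"
  have U: "(a, b) \<in> ?R\<^sup>*" if "a \<in> U" "b \<in> U" for a b
    using assms(1) that rtrancl_mono[of "Restr (arcs_ends G) U" ?R]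
    by (auto simp: connected_in_def)
  have ux: "(u, x) \<in> ?R" "(x, u) \<in> ?R" using assms adj_sym by auto
  have "(a, x) \<in> ?R\<^sup>*" "(x, a) \<in> ?R\<^sup>*" if "a \<in> U" for a
    using U[OF that assms(2)] U[OF assms(2) that] ux
    by (auto intro: rtrancl_into_rtrancl converse_rtrancl_into_rtrancl)
  then show ?thesis using U by (auto simp: connected_in_def)
qed

text \<open>A chord would either join two vertices of one of the two induced paths, or join
  \<open>p\<close> to \<open>q\<close>, which \<open>sep\<close> forbids. As closed neighbourhoods
  contain their centre, \<open>sep\<close> also makes \<open>p\<close> and \<open>q\<close>
  disjoint.\<close>

lemma induced_cycle_glue:
  assumes p: "induced_path G (x # p @ [y])" "p \<noteq> []"
    and q: "induced_path G (y # q @ [x])"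
    and sep: "\<And>v w. v \<in> set p \<Longrightarrow> w \<in> set q \<Longrightarrow> w \<notin> closed_nbhd G v"
  shows "induced_cycle G (x # p @ [y] @ q)"
    and "cycle_contains_path (x # p @ [y] @ q) (x # p @ [y])"
proof -
  let ?c = "x # p @ [y] @ q"
  \<comment> \<open>The second path starts at \<open>y\<close>, where the first ends, and its last
    edge closes the cycle at \<open>x\<close>.\<close>
  have edges: "cycle_edges ?c = walk_edges (x # p @ [y]) \<union> walk_edges (y # q @ [x])"
    using walk_edges_append[of "x # p @ [y]" "q @ [x]"] walk_edges_append[of "[y]" "q @ [x]"]
    by (auto simp: cycle_edges_def walk_edges_def)
  show "cycle_contains_path ?c (x # p @ [y])"
    using edges by (auto simp: cycle_contains_path_def)
  have disj: "set p \<inter> set q = {}"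
    using sep by (auto simp: closed_nbhd_def)
  have dist: "distinct ?c"
    using p(1) q disj by (auto simp: induced_path_iff)
  have "walk_edges (?c @ [hd ?c]) \<subseteq> arcs_ends G"
    using p(1) q edges by (auto simp: induced_path_iff cycle_edges_def)
  then have walk: "vwalk (?c @ [hd ?c]) G"
    using p(1) q unfolding walk_edges_subset_arcs_ends by (auto simp: induced_path_iff vwalk_def)
  have "(v, w) \<in> cycle_edges ?c" if vw: "v \<in> set ?c" "w \<in> set ?c" "v \<rightarrow>\<^bsub>G\<^esub> w" for v w
  proof -
    have "\<not> (v \<in> set p \<and> w \<in> set q)" "\<not> (w \<in> set p \<and> v \<in> set q)"
      using sep[of v w] sep[of w v] vw(3) adj_sym by (auto simp: closed_nbhd_def)
    then consider "v \<in> set (x # p @ [y])" "w \<in> set (x # p @ [y])"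
      | "v \<in> set (y # q @ [x])" "w \<in> set (y # q @ [x])"
      using vw(1,2) by auto
    then show ?thesis
      using p(1) q vw(3) unfolding edges induced_path_iff by cases blast+
  qed
  then show "induced_cycle G ?c"
    using dist walk p(2) by (cases p) (auto simp: induced_cycle_def)
qed

text \<open>Both ends attach to the connected set \<open>U\<close>, so a shortest path joins them
  with its interior in \<open>U\<close>. No vertex of \<open>p\<close> equals or is adjacent to a
  vertex of that interior, so the two paths can be glued.\<close>

lemma induced_cycle_through_connected:
  assumes p: "induced_path G (x # p @ [y])" "p \<noteq> []"
    and U: "connected_in G U" "U \<subseteq> verts G"
    and sep: "set p \<inter> \<Union> (closed_nbhd G ` U) = {}"
    and x: "u \<in> U" "u \<rightarrow>\<^bsub>G\<^esub> x" and y: "v \<in> U" "v \<rightarrow>\<^bsub>G\<^esub> y"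
  shows "\<exists>c. induced_cycle G c \<and> set c \<subseteq> set (x # p @ [y]) \<union> U \<and>
    cycle_contains_path c (x # p @ [y])"
proof -
  let ?S = "insert x (insert y U)"
  have "connected_in G ?S"
    using connected_in_insert[OF connected_in_insert[OF U(1) y], of u x] x by auto
  then have "(y, x) \<in> (Restr (arcs_ends G) ?S)\<^sup>*" by (auto simp: connected_in_def)
  moreover have "?S \<subseteq> verts G" using p(1) U(2) by (auto simp: induced_path_iff)
  ultimately obtain r where r: "induced_path G r" "hd r = y" "last r = x" "set r \<subseteq> ?S"
    using induced_path_if_reachable_within[of y x ?S] by auto
  have "x \<noteq> y" using p(1) by (auto simp: induced_path_iff)
  then obtain q where q: "r = y # q @ [x]"
    using r by (cases r; cases "tl r" rule: rev_cases) (auto simp: induced_path_iff)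
  \<comment> \<open>\<open>r\<close> repeats no vertex, so its interior contains neither
    \<open>x\<close> nor \<open>y\<close>.\<close>
  then have qU: "set q \<subseteq> U" using r by (auto simp: induced_path_iff)
  have "w \<notin> closed_nbhd G v" if "v \<in> set p" "w \<in> set q" for v w
    using that qU sep closed_nbhd_sym by blast
  then show ?thesis
    using induced_cycle_glue[OF p, of q] r(1) qU unfolding q
    by (intro exI[of _ "x # p @ [y] @ q"]) auto
qed

section \<open>Maximal connected sets and induction on the vertex set\<close>

text \<open>This is (ii) relative to \<open>W\<close>, given (i) relative to proper subsets as
  \<open>IH\<close>. It thus serves both inside the induction that proves (i) and, afterwards, for
  (ii) itself.\<close>

lemma avoidable_within_avoiding_nbhd:
  assumes W: "W \<subseteq> verts G" and k: "1 \<le> k" and u: "u \<in> W"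
    and IH: "\<And>H p. H \<subset> W \<Longrightarrow> induced_path G p \<Longrightarrow> set p \<subseteq> H \<Longrightarrow> length p = k \<Longrightarrow>
      \<exists>p. length p = k \<and> avoidable_within G H p"
    and ex: "induced_path G p\<^sub>0" "set p\<^sub>0 \<subseteq> W - closed_nbhd G u" "length p\<^sub>0 = k"
  shows "\<exists>p. length p = k \<and> set p \<subseteq> W - closed_nbhd G u \<and> avoidable_within G W p"
proof -
  define N where "N U = \<Union> (closed_nbhd G ` U)" for U
  define P where "P U \<longleftrightarrow> u \<in> U \<and> U \<subseteq> W \<and> connected_in G U \<and>
      (\<exists>p. induced_path G p \<and> set p \<subseteq> W - N U \<and> length p = k)" for U
  have finW: "finite W" using W finite_verts finite_subset by blast
  have "P {u}" using u ex by (auto simp: P_def N_def connected_in_def)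
  moreover have "\<forall>U. P U \<longrightarrow> card U \<le> card W"
    using finW by (auto simp: P_def intro: card_mono)
  ultimately obtain U where U: "P U" and max: "\<And>U'. P U' \<Longrightarrow> card U' \<le> card U"
    using Lattices_Big.ex_has_greatest_nat[of P "{u}" card "Suc (card W)"]
    by (metis less_Suc_eq_le)
  have UW: "U \<subseteq> W" and conn: "connected_in G U" and uU: "u \<in> U" using U by (auto simp: P_def)
  have UN: "U \<subseteq> N U" by (auto simp: N_def closed_nbhd_def)
  \<comment> \<open>The vertex \<open>u\<close> is lost, which makes \<open>IH\<close>
    applicable.\<close>
  then have "W - N U \<subset> W" using uU u by auto
  moreover obtain q where "induced_path G q" "set q \<subseteq> W - N U" "length q = k"
    using U unfolding P_def by blast
  ultimately obtain p where len: "length p = k" and p: "avoidable_within G (W - N U) p"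
    using IH by blast
  have ip: "induced_path G p" and pW: "set p \<subseteq> W - N U"
    using p by (auto simp: avoidable_within_def)
  have ne: "p \<noteq> []" using len k by auto
  \<comment> \<open>If \<open>x\<close> were in \<open>U\<close>, its neighbour \<open>hd r\<close>
    would lie in \<open>N U\<close>. The claim is made for any \<open>r\<close> so that it covers
    both \<open>p\<close> and \<open>rev p\<close>.\<close>
  have end_adjacent: "\<exists>v\<in>U. v \<rightarrow>\<^bsub>G\<^esub> x"
    if "induced_path G (x # r @ [y])" "r \<noteq> []" "set r \<subseteq> W - N U" "x \<in> N U" for x y r
  proof -
    have "x \<notin> U"
    proof
      assume "x \<in> U"
      then have "hd r \<in> N U"
        using extension_hd_adjacent[OF that(1,2)] by (auto simp: N_def closed_nbhd_def)
      then show False using that(2,3) by (meson DiffE hd_in_set subsetD)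
    qed
    then show ?thesis using that(4) by (auto simp: N_def closed_nbhd_def)
  qed
  have no_mixed: "y \<in> N U"
    if e: "induced_path G (x # r @ [y])" "r \<noteq> []" "set r \<subseteq> W - N U" "length r = k"
      "x \<in> W" "y \<in> W" "x \<in> N U" for x y r
  proof (rule ccontr)
    assume y: "y \<notin> N U"
    obtain v where v: "v \<in> U" "v \<rightarrow>\<^bsub>G\<^esub> x" using end_adjacent e by blast
    have "hd r \<in> W - N U" using e(2,3) by (meson hd_in_set subsetD)
    then have "x \<notin> U"
      using extension_hd_adjacent[OF e(1,2)] by (auto simp: N_def closed_nbhd_def)
    have "set (tl r @ [y]) \<subseteq> W - N U"
      using e(2,3,6) y by (cases r) auto
    \<comment> \<open>\<open>N (insert x U)\<close> is the union of \<open>N U\<close> and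
      \<open>N[x]\<close>; the shifted path avoids the latter as well.\<close>
    then have "set (tl r @ [y]) \<subseteq> W - N (insert x U)"
      using induced_path_shift(2)[OF e(1,2)] by (auto simp: N_def)
    moreover have "length (tl r @ [y]) = k" using e(2,4) by (cases r) auto
    ultimately have "P (insert x U)"
      unfolding P_def
      using connected_in_insert[OF conn v] induced_path_shift(1)[OF e(1,2)] e(5) uU UW by blast
    from max[OF this] show False
      using \<open>x \<notin> U\<close> finite_subset[OF UW finW] by simp
  qed
  have "\<exists>c. induced_cycle G c \<and> set c \<subseteq> W \<and> cycle_contains_path c (x # p @ [y])"
    if xy: "x \<in> W" "y \<in> W" and e: "induced_path G (x # p @ [y])" for x y
  proof -
    \<comment> \<open>Reversal exchanges the roles of \<open>x\<close> and \<open>y\<close>.\<close>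
    have e': "induced_path G (y # rev p @ [x])"
      using e induced_path_rev[of "x # p @ [y]"] by simp
    have "x \<in> N U \<longleftrightarrow> y \<in> N U"
      using no_mixed[OF e ne pW len xy] no_mixed[OF e', simplified, OF ne pW len xy(2,1)] by blast
    then consider "x \<in> W - N U" "y \<in> W - N U" | "x \<in> N U" "y \<in> N U" using xy by blast
    then show ?thesis
    proof cases
      case 1
      then show ?thesis using p e unfolding avoidable_within_def by blast
    next
      case 2
      obtain v where v: "v \<in> U" "v \<rightarrow>\<^bsub>G\<^esub> x" using end_adjacent[OF e ne pW 2(1)] by blast
      obtain w where w: "w \<in> U" "w \<rightarrow>\<^bsub>G\<^esub> y"
        using end_adjacent[OF e', simplified, OF ne pW 2(2)] by blast
      have "set p \<inter> \<Union> (closed_nbhd G ` U) = {}" using pW by (auto simp: N_def)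
      then obtain c where "induced_cycle G c" "set c \<subseteq> set (x # p @ [y]) \<union> U"
          "cycle_contains_path c (x # p @ [y])"
        using induced_cycle_through_connected[OF e ne conn _ _ v w] UW W by blast
      \<comment> \<open>\<open>U \<subseteq> W\<close> keeps the new cycle inside
        \<open>W\<close>.\<close>
      moreover have "set (x # p @ [y]) \<union> U \<subseteq> W" using xy pW UW by auto
      ultimately show ?thesis by blast
    qed
  qed
  then have "avoidable_within G W p"
    using ip pW by (auto simp: avoidable_within_def)
  moreover have "set p \<subseteq> W - closed_nbhd G u" using pW uU by (auto simp: N_def)
  ultimately show ?thesis using len by blast
qed

lemma avoidable_within_exists:
  assumes "W \<subseteq> verts G" "1 \<le> k" "induced_path G p" "set p \<subseteq> W" "length p = k"
  shows "\<exists>p. length p = k \<and> avoidable_within G W p"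
proof -
  have "finite W" using assms(1) finite_verts finite_subset by blast
  then show ?thesis using assms(1,3-5)
  proof (induction W arbitrary: p rule: finite_psubset_induct)
    case (psubset W)
    show ?case
    proof (cases "\<exists>u\<in>W. \<exists>q. induced_path G q \<and> set q \<subseteq> W - closed_nbhd G u \<and> length q = k")
      case True
      then obtain u q where u: "u \<in> W"
        and q: "induced_path G q" "set q \<subseteq> W - closed_nbhd G u" "length q = k" by blast
      have "\<exists>p. length p = k \<and> avoidable_within G H p"
        if "H \<subset> W" "induced_path G p" "set p \<subseteq> H" "length p = k" for H p
        using psubset.IH[OF that(1) _ that(2-4)] that(1) psubset.prems(1) by blast
      then show ?thesis
        using avoidable_within_avoiding_nbhd[OF psubset.prems(1) assms(2) u _ q] by blast
    next
      case False
      have ne: "p \<noteq> []" using psubset.prems assms(2) by auto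
      \<comment> \<open>Without an extension inside \<open>W\<close>, the given \<open>p\<close> is
        vacuously avoidable within \<open>W\<close>.\<close>
      have "\<not> induced_path G (x # p @ [y])" if "x \<in> W" "y \<in> W" for x y
      proof
        assume e: "induced_path G (x # p @ [y])"
        have "set (tl p @ [y]) \<subseteq> W" "length (tl p @ [y]) = k"
          using psubset.prems that ne by (cases p; auto)+
        then show False
          using False that induced_path_shift[OF e ne] by blast
      qed
      then show ?thesis
        using psubset.prems by (auto simp: avoidable_within_def)
    qed
  qed
qed

end

theorem theorem2p4:
  fixes G :: "('a, 'b) pre_digraph" and k :: nat
  assumes "graph G" and "1 \<le> k"
  shows "(\<not> (\<exists>p. induced_path G p \<and> length p = k) \<or>
          (\<exists>p. induced_path G p \<and> length p = k \<and> avoidable G p)) \<and>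
         (\<forall>u\<in>verts G.
            \<not> (\<exists>p. induced_path (delete_verts G (closed_nbhd G u)) p \<and> length p = k) \<or>
            (\<exists>p. induced_path G p \<and> length p = k \<and> set p \<subseteq> verts G - closed_nbhd G u \<and>
                 avoidable G p))"
proof -
  interpret graph G by fact
  have i: "\<exists>p. induced_path G p \<and> length p = k \<and> avoidable G p"
    if "induced_path G p" "length p = k" for p
  proof -
    have "set p \<subseteq> verts G" using that by (simp add: induced_path_iff)
    then show ?thesis
      using avoidable_within_exists[OF subset_refl assms(2) that(1) _ that(2)]
        avoidable_if_avoidable_within_verts by (metis avoidable_def)
  qed
  have ii: "\<exists>p. induced_path G p \<and> length p = k \<and> set p \<subseteq> verts G - closed_nbhd G u \<and> avoidable G p"
    if u: "u \<in> verts G" and p: "induced_path (delete_verts G (closed_nbhd G u)) p" "length p = k"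
    for u p
  proof -
    \<comment> \<open>The completed induction now supplies what was the induction hypothesis, with
      \<open>W = verts G\<close>.\<close>
    have "\<exists>p. length p = k \<and> avoidable_within G H p"
      if "H \<subset> verts G" "induced_path G p" "set p \<subseteq> H" "length p = k" for H p
      using avoidable_within_exists[of H k p] that assms(2) by blast
    then show ?thesis
      using avoidable_within_avoiding_nbhd[OF subset_refl assms(2) u _
          induced_path_delete_verts[OF p(1)] p(2)] avoidable_if_avoidable_within_verts
      by (metis avoidable_def)
  qed
  from i ii show ?thesis by blast
qed

end
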